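(* Fix real numbers $c<d$ and let $N\ge 1$ be an integer. There exists $\varepsilon>0$ such that for each space $X$ among $\mathrm{(ffid^{[c,d]})}$, $\mathrm{(ffid)}$, $\mathrm{(fid)}$, $\mathrm{(cfid)}$, $\mathrm{(cid)}$, $\mathrm{(pfd)}$, $\mathrm{(rid)}$ (each equipped with the interleaving distance $d_I$) there is an isometric embedding of the cube $[0,\varepsilon]^N$ with the $L^\infty$ distance into $X$, i.e. a map $\Phi:[0,\varepsilon]^N\to X$ with $d_I(\Phi(x),\Phi(y))=\|x-y\|_\infty$ for all $x,y\in[0,\varepsilon]^N$.
   Context: Fix a field $\mathbf{k}$. A persistence module is a functor $M:(\mathbb{R},\le)\to \mathrm{Vect}_{\mathbf{k}}$; "persistence module" means isomorphism class of persistence modules. For an interval $J\subset\mathbb{R}$, the interval module $J$ is $\mathbf{k}$ at points of $J$ and $0$ elsewhere, with identity maps between points of $J$ and zero maps otherwise. For $\varepsilon\ge 0$, persistence modules $M,N$ are $\varepsilon$-interleaved if there are families of linear maps $\varphi_a:M(a)\to N(a+\varepsilon)$ and $\psi_a:N(a)\to M(a+\varepsilon)$, natural in $a\in\mathbb{R}$, with $\psi_{a+\varepsilon}\varphi_a=M(a\le a+2\varepsilon)$ and $\varphi_{a+\varepsilon}\psi_a=N(a\le a+2\varepsilon)$ for all $a$. The interleaving distance is $d_I(M,N)=\inf\{\varepsilon\ge0 : M,N \text{ are } \varepsilon\text{-interleaved}\}$ ($\infty$ if there is none); it is an extended pseudometric. Spaces (sets of persistence modules with $d_I$): $\mathrm{(fid)}$: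 finite direct sums of interval modules (including the zero module); $\mathrm{(ffid)}$: those in $\mathrm{(fid)}$ with all intervals finite (bounded); $\mathrm{(ffid^{[c,d]})}$: those in $\mathrm{(ffid)}$ with all intervals contained in $[c,d]$; $\mathrm{(cid)}$: direct sums of countably many interval modules; $\mathrm{(cfid)}$: those in $\mathrm{(cid)}$ with all intervals finite (bounded); $\mathrm{(pfd)}$: persistence modules $M$ with every $M(a)$ finite dimensional; $\mathrm{(rid)}$: direct sums $\bigoplus_{\alpha\in A}I_\alpha$ of interval modules with $|A|\le|\mathbb{R}|$. *)

theory Defs
  imports "HOL-Analysis.Analysis" "HOL-Library.Function_Algebras"
begin

text \<open>
  A persistence module is a functor from the reals to vector spaces. Its value at a point is a
  subspace of an ambient vector space ('v with scalar multiplication s); values outside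
  these subspaces are junk. Throughout, the ambient space used is real \<Rightarrow> 'k with pointwise
  operations. It has dimension at least that of the continuum, so every pointwise finite
  dimensional module and every direct sum of at most continuum many interval modules has an
  isomorphic copy in it.
\<close>

record 'v pmod =
  pm_space :: "real \<Rightarrow> 'v set"
  pm_map :: "real \<Rightarrow> real \<Rightarrow> 'v \<Rightarrow> 'v"

definition linear_between ::
  "('k::field \<Rightarrow> 'v::ab_group_add \<Rightarrow> 'v) \<Rightarrow> 'v set \<Rightarrow> 'v set \<Rightarrow> ('v \<Rightarrow> 'v) \<Rightarrow> bool" where
  "linear_between s V W f \<longleftrightarrow>
     f ` V \<subseteq> W \<and>
     (\<forall>x\<in>V. \<forall>y\<in>V. f (x + y) = f x + f y) \<and>
     (\<forall>c. \<forall>x\<in>V. f (s c x) = s c (f x))"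

definition persistence_module ::
  "('k::field \<Rightarrow> 'v::ab_group_add \<Rightarrow> 'v) \<Rightarrow> 'v pmod \<Rightarrow> bool" where
  "persistence_module s M \<longleftrightarrow>
     (\<forall>a. module.subspace s (pm_space M a)) \<and>
     (\<forall>a b. a \<le> b \<longrightarrow> linear_between s (pm_space M a) (pm_space M b) (pm_map M a b)) \<and>
     (\<forall>a. \<forall>x\<in>pm_space M a. pm_map M a a x = x) \<and>
     (\<forall>a b c. a \<le> b \<longrightarrow> b \<le> c \<longrightarrow>
        (\<forall>x\<in>pm_space M a. pm_map M b c (pm_map M a b x) = pm_map M a c x))"

definition pm_hom ::
  "('k::field \<Rightarrow> 'v::ab_group_add \<Rightarrow> 'v) \<Rightarrow> 'v pmod \<Rightarrow> 'v pmod \<Rightarrow> (real \<Rightarrow> 'v \<Rightarrow> 'v) \<Rightarrow> bool" where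
  "pm_hom s M N f \<longleftrightarrow>
     (\<forall>a. linear_between s (pm_space M a) (pm_space N a) (f a)) \<and>
     (\<forall>a b. a \<le> b \<longrightarrow> (\<forall>x\<in>pm_space M a. f b (pm_map M a b x) = pm_map N a b (f a x)))"

definition pm_iso ::
  "('k::field \<Rightarrow> 'v::ab_group_add \<Rightarrow> 'v) \<Rightarrow> ('v pmod \<times> 'v pmod) set" where
  "pm_iso s = {(M, N). persistence_module s M \<and> persistence_module s N \<and>
     (\<exists>f. pm_hom s M N f \<and> (\<forall>a. bij_betw (f a) (pm_space M a) (pm_space N a)))}"

definition pm_shift :: "real \<Rightarrow> 'v pmod \<Rightarrow> 'v pmod" where
  "pm_shift e M = \<lparr> pm_space = (\<lambda>a. pm_space M (a + e)),
                    pm_map = (\<lambda>a b. pm_map M (a + e) (b + e)) \<rparr>"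

definition interleaved ::
  "('k::field \<Rightarrow> 'v::ab_group_add \<Rightarrow> 'v) \<Rightarrow> real \<Rightarrow> 'v pmod \<Rightarrow> 'v pmod \<Rightarrow> bool" where
  "interleaved s e M N \<longleftrightarrow>
     (\<exists>\<phi> \<psi>. pm_hom s M (pm_shift e N) \<phi> \<and> pm_hom s N (pm_shift e M) \<psi> \<and>
        (\<forall>a. \<forall>x\<in>pm_space M a. \<psi> (a + e) (\<phi> a x) = pm_map M a (a + 2 * e) x) \<and>
        (\<forall>a. \<forall>x\<in>pm_space N a. \<phi> (a + e) (\<psi> a x) = pm_map N a (a + 2 * e) x))"

definition interleaving_distance ::
  "('k::field \<Rightarrow> 'v::ab_group_add \<Rightarrow> 'v) \<Rightarrow> 'v pmod \<Rightarrow> 'v pmod \<Rightarrow> ereal" where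
  "interleaving_distance s M N = Inf {ereal e | e. 0 \<le> e \<and> interleaved s e M N}"

definition interval_module :: "real set \<Rightarrow> 'k::field pmod" where
  "interval_module J = \<lparr> pm_space = (\<lambda>a. if a \<in> J then UNIV else {0}),
                         pm_map = (\<lambda>a b x. if a \<in> J \<and> b \<in> J then x else 0) \<rparr>"

definition pm_direct_sum :: "'i set \<Rightarrow> ('i \<Rightarrow> 'v::ab_group_add pmod) \<Rightarrow> ('i \<Rightarrow> 'v) pmod" where
  "pm_direct_sum A M =
     \<lparr> pm_space = (\<lambda>a. {f. finite {i. f i \<noteq> 0} \<and> (\<forall>i\<in>A. f i \<in> pm_space (M i) a) \<and>
                           (\<forall>i. i \<notin> A \<longrightarrow> f i = 0)}),
       pm_map = (\<lambda>a b f i. if i \<in> A then pm_map (M i) a b (f i) else 0) \<rparr>"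

definition fun_scale :: "'k::field \<Rightarrow> ('i \<Rightarrow> 'k) \<Rightarrow> 'i \<Rightarrow> 'k" where
  "fun_scale c f = (\<lambda>i. c * f i)"

lemma vector_space_fun_scale: "vector_space (fun_scale :: 'k::field \<Rightarrow> ('i \<Rightarrow> 'k) \<Rightarrow> 'i \<Rightarrow> 'k)"
  by unfold_locales (auto simp: fun_scale_def fun_eq_iff algebra_simps)

text \<open>
  Isomorphism classes of direct sums of interval modules with index set \<open>A\<close> and intervals
  \<open>I \<alpha>\<close> satisfying \<open>P A I\<close>. An index set has cardinality at most that of the reals iff it is in
  bijection with a set of reals, so real indices lose no generality.
\<close>

definition interval_sums ::
  "(real set \<Rightarrow> (real \<Rightarrow> real set) \<Rightarrow> bool) \<Rightarrow> (real \<Rightarrow> 'k::field) pmod set set" where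
  "interval_sums P =
     {M. \<exists>A I. (\<forall>\<alpha>\<in>A. is_interval (I \<alpha>) \<and> I \<alpha> \<noteq> {}) \<and> P A I \<and>
        (M, pm_direct_sum A (\<lambda>\<alpha>. interval_module (I \<alpha>))) \<in> pm_iso fun_scale}
     // pm_iso fun_scale"

definition fid :: "(real \<Rightarrow> 'k::field) pmod set set" where
  "fid = interval_sums (\<lambda>A I. finite A)"

definition ffid :: "(real \<Rightarrow> 'k::field) pmod set set" where
  "ffid = interval_sums (\<lambda>A I. finite A \<and> (\<forall>\<alpha>\<in>A. bounded (I \<alpha>)))"

definition ffid_within :: "real \<Rightarrow> real \<Rightarrow> (real \<Rightarrow> 'k::field) pmod set set" where
  "ffid_within c d =
     interval_sums (\<lambda>A I. finite A \<and> (\<forall>\<alpha>\<in>A. bounded (I \<alpha>) \<and> I \<alpha> \<subseteq> {c..d}))"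

text \<open>As usual for these spaces, ``countably many'' includes finitely many.\<close>

definition cid :: "(real \<Rightarrow> 'k::field) pmod set set" where
  "cid = interval_sums (\<lambda>A I. countable A)"

definition cfid :: "(real \<Rightarrow> 'k::field) pmod set set" where
  "cfid = interval_sums (\<lambda>A I. countable A \<and> (\<forall>\<alpha>\<in>A. bounded (I \<alpha>)))"

definition rid :: "(real \<Rightarrow> 'k::field) pmod set set" where
  "rid = interval_sums (\<lambda>A I. True)"

definition pfd :: "(real \<Rightarrow> 'k::field) pmod set set" where
  "pfd =
     {M. persistence_module fun_scale M \<and>
        (\<forall>a. \<exists>B. finite B \<and> pm_space M a = module.span fun_scale B)}
     // pm_iso fun_scale"

text \<open>
  On isomorphism classes; the distance of two modules only depends on their classes, so the
  infimum is over a constant.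
\<close>

definition d_I ::
  "(real \<Rightarrow> 'k::field) pmod set \<Rightarrow> (real \<Rightarrow> 'k) pmod set \<Rightarrow> ereal" where
  "d_I C D = (INF M\<in>C. INF N\<in>D. interleaving_distance fun_scale M N)"

end

theory Submission
  imports Defs
begin

text \<open>
  One map serves all seven spaces. Put \<open>\<epsilon> = (d - c) / (4 N)\<close> and split \<open>[c, d]\<close> into \<open>N\<close> cells of
  length \<open>4 \<epsilon>\<close>. The point \<open>x\<close> of the cube is sent to the direct sum of \<open>N\<close> bars, the one in the
  \<open>k\<close>-th cell starting at the left end of the cell and having length \<open>2 \<epsilon> + x\<^sub>k\<close>. This is a finite
  sum of bounded intervals inside \<open>[c, d]\<close>, so it lies in each of the spaces.

  Moving the endpoints of all bars by at most \<open>e\<close> gives an \<open>e\<close>-interleaved module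
  (\<open>interleaved_perturb_endpoints\<close>), so the distance of two such modules is at most the
  \<open>L\<^sup>\<infinity>\<close> distance.

  For the lower bound, an \<open>e\<close>-interleaving factors \<open>M(s - e) \<rightarrow> M(t + e)\<close> through \<open>N(s) \<rightarrow> N(t)\<close>, so
  if the latter vanishes then so does the former (\<open>interleaved_zero_map\<close>). Suppose
  \<open>e < x\<^sub>k - y\<^sub>k\<close>, so that \<open>e < \<epsilon>\<close> and a bar survives shortening by \<open>e\<close> at both ends. Take \<open>[s - e, t + e]\<close> to be the \<open>k\<close>-th bar of \<open>x\<close>. The long bar carries a
  nonzero map from \<open>s - e\<close> to \<open>t + e\<close>. But \<open>s\<close> lies inside the \<open>k\<close>-th cell, so among the bars of \<open>y\<close> only
  the \<open>k\<close>-th could contain both \<open>s\<close> and \<open>t\<close>, and it ends before \<open>t\<close>. Vanishing of structure maps is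
  invariant under isomorphism, so the bound holds for all representatives of the two classes.
\<close>

section \<open>Direct sums of interval modules\<close>

definition bar_sum :: "real set \<Rightarrow> (real \<Rightarrow> real set) \<Rightarrow> (real \<Rightarrow> 'k::field) pmod" where
  "bar_sum A I = pm_direct_sum A (\<lambda>\<alpha>. interval_module (I \<alpha>))"

text \<open>
  Structure maps of sums of interval modules, and the interleaving maps between them, all keep some
  coordinates and annihilate the others.
\<close>

definition restrict_coords :: "('i \<Rightarrow> bool) \<Rightarrow> ('i \<Rightarrow> 'k::zero) \<Rightarrow> 'i \<Rightarrow> 'k" where
  "restrict_coords P f = (\<lambda>i. if P i then f i else 0)"

lemma module_fun_scale: "module (fun_scale :: 'k::field \<Rightarrow> ('i \<Rightarrow> 'k) \<Rightarrow> 'i \<Rightarrow> 'k)"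
  using vector_space_fun_scale by (simp add: module_iff_vector_space)

lemma pm_space_bar_sum:
  "pm_space (bar_sum A I) a = {f. finite {i. f i \<noteq> 0} \<and> (\<forall>i. f i \<noteq> 0 \<longrightarrow> i \<in> A \<and> a \<in> I i)}"
  unfolding bar_sum_def pm_direct_sum_def interval_module_def by auto

lemma pm_map_bar_sum:
  "pm_map (bar_sum A I) a b = restrict_coords (\<lambda>i. i \<in> A \<and> a \<in> I i \<and> b \<in> I i)"
  unfolding bar_sum_def pm_direct_sum_def interval_module_def restrict_coords_def by (auto simp: fun_eq_iff)

lemma linear_between_restrict_coords:
  assumes "\<And>i. i \<in> A \<Longrightarrow> a \<in> I i \<Longrightarrow> P i \<Longrightarrow> b \<in> J i"
  shows "linear_between fun_scale (pm_space (bar_sum A I :: (real \<Rightarrow> 'k::field) pmod) a)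
           (pm_space (bar_sum A J) b) (restrict_coords P)"
proof -
  have "restrict_coords P f \<in> pm_space (bar_sum A J) b"
    if f: "f \<in> pm_space (bar_sum A I :: (real \<Rightarrow> 'k) pmod) a" for f
  proof -
    have "finite {i. restrict_coords P f i \<noteq> 0}"
      by (rule finite_subset[of _ "{i. f i \<noteq> 0}"])
         (use f in \<open>auto simp: pm_space_bar_sum restrict_coords_def\<close>)
    then show ?thesis
      using f assms by (auto simp: pm_space_bar_sum restrict_coords_def)
  qed
  then show ?thesis
    by (auto simp: linear_between_def restrict_coords_def fun_scale_def fun_eq_iff)
qed

lemma subspace_bar_sum:
  "module.subspace fun_scale (pm_space (bar_sum A I :: (real \<Rightarrow> 'k::field) pmod) a)"
proof -
  interpret vector_space "fun_scale :: 'k \<Rightarrow> (real \<Rightarrow> 'k) \<Rightarrow> real \<Rightarrow> 'k"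
    by (rule vector_space_fun_scale)
  have add: "f + g \<in> pm_space (bar_sum A I) a"
    if f: "f \<in> pm_space (bar_sum A I) a" and g: "g \<in> pm_space (bar_sum A I) a"
    for f g :: "real \<Rightarrow> 'k"
  proof -
    have "{i. (f + g) i \<noteq> 0} \<subseteq> {i. f i \<noteq> 0} \<union> {i. g i \<noteq> 0}"
      by auto
    then have "finite {i. (f + g) i \<noteq> 0}"
      using f g by (auto simp: pm_space_bar_sum intro: finite_subset)
    moreover have "i \<in> A \<and> a \<in> I i" if "(f + g) i \<noteq> 0" for i
    proof (cases "f i = 0")
      case True
      then show ?thesis using that g by (auto simp: pm_space_bar_sum)
    next
      case False
      then show ?thesis using f by (auto simp: pm_space_bar_sum)
    qed
    ultimately show ?thesis by (auto simp: pm_space_bar_sum)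
  qed
  have scale: "fun_scale r f \<in> pm_space (bar_sum A I) a"
    if f: "f \<in> pm_space (bar_sum A I) a" for r and f :: "real \<Rightarrow> 'k"
    using f by (auto simp: pm_space_bar_sum fun_scale_def intro: rev_finite_subset)
  have "0 \<in> pm_space (bar_sum A I :: (real \<Rightarrow> 'k) pmod) a"
    by (simp add: pm_space_bar_sum)
  with add scale show ?thesis
    unfolding subspace_def by blast
qed

lemma persistence_module_bar_sum:
  assumes "\<And>\<alpha>. \<alpha> \<in> A \<Longrightarrow> is_interval (I \<alpha>)"
  shows "persistence_module fun_scale (bar_sum A I :: (real \<Rightarrow> 'k::field) pmod)"
proof -
  let ?M = "bar_sum A I :: (real \<Rightarrow> 'k) pmod"
  have conv: "b \<in> I i" if "i \<in> A" "a \<in> I i" "c \<in> I i" "a \<le> b" "b \<le> c" for i a b c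
    using assms[OF that(1)] that(2-) unfolding is_interval_1 by blast
  have "linear_between fun_scale (pm_space ?M a) (pm_space ?M b) (pm_map ?M a b)" for a b
    unfolding pm_map_bar_sum by (rule linear_between_restrict_coords) simp
  moreover have "pm_map ?M a a f = f" if "f \<in> pm_space ?M a" for a f
    using that by (auto simp: pm_map_bar_sum restrict_coords_def pm_space_bar_sum fun_eq_iff)
  moreover have "pm_map ?M b c (pm_map ?M a b f) = pm_map ?M a c f" if "a \<le> b" "b \<le> c" for a b c f
    unfolding pm_map_bar_sum restrict_coords_def fun_eq_iff using conv[OF _ _ _ that] by simp
  ultimately show ?thesis
    unfolding persistence_module_def using subspace_bar_sum by blast
qed

lemma finite_dim_bar_sum:
  assumes "finite A"
  shows "\<exists>B. finite B \<and> pm_space (bar_sum A I :: (real \<Rightarrow> 'k::field) pmod) a = module.span fun_scale B"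
proof -
  interpret vector_space "fun_scale :: 'k \<Rightarrow> (real \<Rightarrow> 'k) \<Rightarrow> real \<Rightarrow> 'k"
    by (rule vector_space_fun_scale)
  define e :: "real \<Rightarrow> real \<Rightarrow> 'k" where "e i = (\<lambda>j. if j = i then 1 else 0)" for i
  define S where "S = {i \<in> A. a \<in> I i}"
  have "finite S" using assms by (simp add: S_def)
  have "f \<in> span (e ` S)" if f: "f \<in> pm_space (bar_sum A I) a" for f
  proof -
    have "f = (\<Sum>i\<in>S. fun_scale (f i) (e i))"
    proof
      fix j
      have "(\<Sum>i\<in>S. fun_scale (f i) (e i)) j = (\<Sum>i\<in>S. f i * e i j)"
        using \<open>finite S\<close> by (induction S rule: finite_induct) (auto simp: fun_scale_def)
      also have "\<dots> = (\<Sum>i\<in>S. if j = i then f i else 0)"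
        by (rule sum.cong) (auto simp: e_def)
      also have "\<dots> = f j"
        using \<open>finite S\<close> f by (auto simp: pm_space_bar_sum S_def)
      finally show "f j = (\<Sum>i\<in>S. fun_scale (f i) (e i)) j" by simp
    qed
    also have "\<dots> \<in> span (e ` S)"
      by (intro span_sum span_scale span_base imageI)
    finally show ?thesis .
  qed
  moreover have "e ` S \<subseteq> pm_space (bar_sum A I) a"
    by (auto simp: pm_space_bar_sum e_def S_def split: if_splits)
  then have "span (e ` S) \<subseteq> pm_space (bar_sum A I) a"
    by (rule span_minimal) (rule subspace_bar_sum)
  ultimately show ?thesis
    using \<open>finite S\<close> by (intro exI[of _ "e ` S"]) auto
qed

lemma bar_sum_map_eq_0_iff:
  "(\<forall>v\<in>pm_space (bar_sum A I :: (real \<Rightarrow> 'k::field) pmod) s. pm_map (bar_sum A I) s t v = 0) \<longleftrightarrow>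
     (\<forall>i\<in>A. \<not> (s \<in> I i \<and> t \<in> I i))"
proof (intro iffI ballI notI)
  fix i
  assume zero: "\<forall>v\<in>pm_space (bar_sum A I :: (real \<Rightarrow> 'k) pmod) s. pm_map (bar_sum A I) s t v = 0"
    and i: "i \<in> A" "s \<in> I i \<and> t \<in> I i"
  \<comment> \<open>The unit vector of a bar containing both points is not annihilated.\<close>
  define u :: "real \<Rightarrow> 'k" where "u = (\<lambda>j. if j = i then 1 else 0)"
  have "u \<in> pm_space (bar_sum A I) s"
    using i by (auto simp: pm_space_bar_sum u_def)
  then have "pm_map (bar_sum A I) s t u i = 0"
    using zero by simp
  then show False
    using i by (simp add: pm_map_bar_sum restrict_coords_def u_def)
qed (auto simp: pm_map_bar_sum restrict_coords_def fun_eq_iff)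

section \<open>Interleavings\<close>

lemma interleaved_sym: "interleaved s e M N \<Longrightarrow> interleaved s e N M"
  unfolding interleaved_def by blast

text \<open>
  Matching equally indexed bars: a nonzero map \<open>[p, q] \<rightarrow> [p' - e, q' - e]\<close> is natural because
  the target starts and ends no later than the source, and both \<open>a\<close> and \<open>a + 2 e\<close> can only lie in
  \<open>[p, q]\<close> if \<open>a + e\<close> lies in \<open>[p', q']\<close>.
\<close>

lemma interleaved_perturb_endpoints:
  fixes p q p' q' :: "real \<Rightarrow> real"
  assumes "\<And>i. i \<in> A \<Longrightarrow> \<bar>p i - p' i\<bar> \<le> e" "\<And>i. i \<in> A \<Longrightarrow> \<bar>q i - q' i\<bar> \<le> e"
  shows "interleaved fun_scale e
           (bar_sum A (\<lambda>i. {p i..q i}) :: (real \<Rightarrow> 'k::field) pmod) (bar_sum A (\<lambda>i. {p' i..q' i}))"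
proof -
  define \<phi> :: "(real \<Rightarrow> real) \<Rightarrow> (real \<Rightarrow> real) \<Rightarrow> (real \<Rightarrow> real) \<Rightarrow> (real \<Rightarrow> real) \<Rightarrow> real \<Rightarrow>
      (real \<Rightarrow> 'k) \<Rightarrow> real \<Rightarrow> 'k"
    where "\<phi> p q p' q' a = restrict_coords (\<lambda>i. a \<in> {p i..q i} \<and> a + e \<in> {p' i..q' i})" for p q p' q' a
  have hom: "pm_hom fun_scale (bar_sum A (\<lambda>i. {p i..q i}))
      (pm_shift e (bar_sum A (\<lambda>i. {p' i..q' i}))) (\<phi> p q p' q')"
    if "\<And>i. i \<in> A \<Longrightarrow> \<bar>p i - p' i\<bar> \<le> e" "\<And>i. i \<in> A \<Longrightarrow> \<bar>q i - q' i\<bar> \<le> e" for p q p' q'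
  proof -
    have "\<phi> p q p' q' b (pm_map (bar_sum A (\<lambda>i. {p i..q i})) a b f) i =
          pm_map (bar_sum A (\<lambda>i. {p' i..q' i})) (a + e) (b + e) (\<phi> p q p' q' a f) i"
      if "a \<le> b" and f: "f \<in> pm_space (bar_sum A (\<lambda>i. {p i..q i})) a" for a b f i
    proof (cases "f i = 0")
      case False
      then have i: "i \<in> A" "a \<in> {p i..q i}"
        using f by (auto simp: pm_space_bar_sum)
      show ?thesis
        using \<open>a \<le> b\<close> i \<open>\<And>i. i \<in> A \<Longrightarrow> \<bar>p i - p' i\<bar> \<le> e\<close>[OF i(1)]
          \<open>\<And>i. i \<in> A \<Longrightarrow> \<bar>q i - q' i\<bar> \<le> e\<close>[OF i(1)]
        by (auto simp: pm_map_bar_sum \<phi>_def restrict_coords_def)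
    qed (simp add: pm_map_bar_sum \<phi>_def restrict_coords_def)
    then show ?thesis
      unfolding pm_hom_def pm_shift_def
      by (auto simp: \<phi>_def intro!: linear_between_restrict_coords)
  qed
  have comp: "\<phi> p' q' p q (a + e) (\<phi> p q p' q' a f) = pm_map (bar_sum A (\<lambda>i. {p i..q i})) a (a + 2 * e) f"
    if "\<And>i. i \<in> A \<Longrightarrow> \<bar>p i - p' i\<bar> \<le> e" "\<And>i. i \<in> A \<Longrightarrow> \<bar>q i - q' i\<bar> \<le> e"
      and f: "f \<in> pm_space (bar_sum A (\<lambda>i. {p i..q i})) a" for p q p' q' a f
  proof
    fix i
    show "\<phi> p' q' p q (a + e) (\<phi> p q p' q' a f) i = pm_map (bar_sum A (\<lambda>i. {p i..q i})) a (a + 2 * e) f i"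
    proof (cases "f i = 0")
      case False
      then have i: "i \<in> A" "a \<in> {p i..q i}"
        using f by (auto simp: pm_space_bar_sum)
      show ?thesis
        using i that(1)[OF i(1)] that(2)[OF i(1)]
        by (auto simp: pm_map_bar_sum \<phi>_def restrict_coords_def)
    qed (simp add: pm_map_bar_sum \<phi>_def restrict_coords_def)
  qed
  have rev: "\<And>i. i \<in> A \<Longrightarrow> \<bar>p' i - p i\<bar> \<le> e" "\<And>i. i \<in> A \<Longrightarrow> \<bar>q' i - q i\<bar> \<le> e"
    using assms by (simp_all add: abs_minus_commute)
  show ?thesis
    unfolding interleaved_def
  proof (intro exI conjI allI ballI)
    show "pm_hom fun_scale (bar_sum A (\<lambda>i. {p i..q i}))
        (pm_shift e (bar_sum A (\<lambda>i. {p' i..q' i}))) (\<phi> p q p' q')"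
      by (rule hom) (fact assms)+
    show "pm_hom fun_scale (bar_sum A (\<lambda>i. {p' i..q' i}))
        (pm_shift e (bar_sum A (\<lambda>i. {p i..q i}))) (\<phi> p' q' p q)"
      by (rule hom) (fact rev)+
    show "\<phi> p' q' p q (a + e) (\<phi> p q p' q' a f) = pm_map (bar_sum A (\<lambda>i. {p i..q i})) a (a + 2 * e) f"
      if "f \<in> pm_space (bar_sum A (\<lambda>i. {p i..q i})) a" for a f
      by (rule comp) (fact assms that)+
    show "\<phi> p q p' q' (a + e) (\<phi> p' q' p q a f) = pm_map (bar_sum A (\<lambda>i. {p' i..q' i})) a (a + 2 * e) f"
      if "f \<in> pm_space (bar_sum A (\<lambda>i. {p' i..q' i})) a" for a f
      by (rule comp) (fact rev that)+
  qed
qed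

lemma linear_between_zero:
  assumes "linear_between sc V W f" "0 \<in> V"
  shows "f 0 = 0"
proof -
  have "f (0 + 0) = f 0 + f 0"
    using assms unfolding linear_between_def by blast
  then show ?thesis by simp
qed

text \<open>
  The map \<open>M(s - e) \<rightarrow> M(t + e)\<close> factors as \<open>M(s - e) \<rightarrow> N(s) \<rightarrow> N(t) \<rightarrow> M(t + e)\<close>, by naturality
  of the second interleaving map.
\<close>

lemma interleaved_zero_map:
  assumes M: "persistence_module sc M" and N: "persistence_module sc N"
    and il: "interleaved sc e M N" and "0 \<le> e" "s \<le> t"
    and zero: "\<forall>v\<in>pm_space N s. pm_map N s t v = 0"
  shows "\<forall>x\<in>pm_space M (s - e). pm_map M (s - e) (t + e) x = 0"
proof
  fix x assume x: "x \<in> pm_space M (s - e)"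
  obtain \<phi> \<psi> where \<phi>: "pm_hom sc M (pm_shift e N) \<phi>" and \<psi>: "pm_hom sc N (pm_shift e M) \<psi>"
    and comp: "\<And>a x. x \<in> pm_space M a \<Longrightarrow> \<psi> (a + e) (\<phi> a x) = pm_map M a (a + 2 * e) x"
    using il unfolding interleaved_def by blast
  define y where "y = \<phi> (s - e) x"
  have "y \<in> pm_space (pm_shift e N) (s - e)"
    using \<phi> x unfolding y_def pm_hom_def linear_between_def by blast
  then have y: "y \<in> pm_space N s"
    by (simp add: pm_shift_def)
  have "linear_between sc (pm_space N s) (pm_space N t) (pm_map N s t)"
    using N \<open>s \<le> t\<close> by (simp add: persistence_module_def)
  then have "pm_map N s t y \<in> pm_space N t"
    using y unfolding linear_between_def by blast
  then have "\<psi> t 0 = 0"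
    using \<psi> y zero by (auto simp: pm_hom_def intro: linear_between_zero)
  have "pm_map M (s - e) (t + e) x = pm_map M (s + e) (t + e) (pm_map M (s - e) (s + e) x)"
    using M x \<open>0 \<le> e\<close> \<open>s \<le> t\<close> by (simp add: persistence_module_def)
  also have "pm_map M (s - e) (s + e) x = \<psi> s y"
    using comp[OF x] by (simp add: y_def add.commute)
  also have "pm_map M (s + e) (t + e) (\<psi> s y) = \<psi> t (pm_map N s t y)"
    using \<psi> y \<open>s \<le> t\<close> by (simp add: pm_hom_def pm_shift_def)
  also have "\<dots> = 0"
    using zero y \<open>\<psi> t 0 = 0\<close> by simp
  finally show "pm_map M (s - e) (t + e) x = 0" .
qed

lemma pm_iso_zero_map_iff:
  assumes "module sc" and iso: "(M, N) \<in> pm_iso sc" and "s \<le> t"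
  shows "(\<forall>v\<in>pm_space M s. pm_map M s t v = 0) \<longleftrightarrow> (\<forall>w\<in>pm_space N s. pm_map N s t w = 0)"
proof -
  obtain f where M: "persistence_module sc M" and hom: "pm_hom sc M N f"
    and bij: "\<And>a. bij_betw (f a) (pm_space M a) (pm_space N a)"
    using iso by (auto simp: pm_iso_def)
  have nat: "f t (pm_map M s t v) = pm_map N s t (f s v)" if "v \<in> pm_space M s" for v
    using hom that \<open>s \<le> t\<close> by (simp add: pm_hom_def)
  have Mt: "pm_map M s t v \<in> pm_space M t" if "v \<in> pm_space M s" for v
    using M that \<open>s \<le> t\<close> unfolding persistence_module_def linear_between_def by blast
  have M0: "0 \<in> pm_space M t"
    using M module.subspace_0[OF \<open>module sc\<close>] by (simp add: persistence_module_def)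
  then have ft0: "f t 0 = 0"
    using hom by (auto simp: pm_hom_def intro: linear_between_zero)
  have "pm_map M s t v = 0 \<longleftrightarrow> pm_map N s t (f s v) = 0" if v: "v \<in> pm_space M s" for v
  proof
    assume "pm_map M s t v = 0"
    then show "pm_map N s t (f s v) = 0"
      using nat[OF v] Mt[OF v] ft0 by simp
  next
    assume "pm_map N s t (f s v) = 0"
    then show "pm_map M s t v = 0"
      using nat[OF v] Mt[OF v] M0 ft0 bij[of t] by (metis bij_betw_def inj_onD)
  qed
  then have "(\<forall>v\<in>pm_space M s. pm_map M s t v = 0) \<longleftrightarrow> (\<forall>w\<in>f s ` pm_space M s. pm_map N s t w = 0)"
    by simp
  then show ?thesis
    unfolding bij_betw_imp_surj_on[OF bij] .
qed

text \<open>
  A bar of the first module containing \<open>s - e\<close> and \<open>t + e\<close> carries a nonzero map between these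
  points, hence the second module has a nonzero map from \<open>s\<close> to \<open>t\<close>. The statement is about representatives because the
  distance of isomorphism classes is an infimum over them.
\<close>

lemma interleaved_bar_sum_imp_bar:
  fixes M N :: "(real \<Rightarrow> 'k::field) pmod"
  assumes isoM: "(bar_sum A I, M) \<in> pm_iso fun_scale" and isoN: "(bar_sum B J, N) \<in> pm_iso fun_scale"
    and il: "interleaved fun_scale e M N" and "0 \<le> e" "s \<le> t"
    and i: "i \<in> A" "s - e \<in> I i" "t + e \<in> I i"
  obtains j where "j \<in> B" "s \<in> J j" "t \<in> J j"
proof -
  have "\<not> (\<forall>j\<in>B. \<not> (s \<in> J j \<and> t \<in> J j))"
  proof
    assume "\<forall>j\<in>B. \<not> (s \<in> J j \<and> t \<in> J j)"
    then have "\<forall>w\<in>pm_space N s. pm_map N s t w = 0"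
      unfolding pm_iso_zero_map_iff[OF module_fun_scale isoN \<open>s \<le> t\<close>, symmetric] bar_sum_map_eq_0_iff .
    moreover have "persistence_module fun_scale M" "persistence_module fun_scale N"
      using isoM isoN by (auto simp: pm_iso_def)
    ultimately have "\<forall>x\<in>pm_space M (s - e). pm_map M (s - e) (t + e) x = 0"
      by (intro interleaved_zero_map[OF _ _ il \<open>0 \<le> e\<close> \<open>s \<le> t\<close>])
    moreover have le: "s - e \<le> t + e" using \<open>0 \<le> e\<close> \<open>s \<le> t\<close> by simp
    ultimately have "\<forall>j\<in>A. \<not> (s - e \<in> I j \<and> t + e \<in> I j)"
      unfolding pm_iso_zero_map_iff[OF module_fun_scale isoM le, symmetric] bar_sum_map_eq_0_iff by blast
    then show False using i by blast
  qed
  then show thesis using that by blast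
qed

section \<open>Isomorphism classes\<close>

lemma pm_iso_refl: "persistence_module sc M \<Longrightarrow> (M, M) \<in> pm_iso sc"
  unfolding pm_iso_def pm_hom_def
  by (simp, rule exI[of _ "\<lambda>a x. x"]) (simp add: linear_between_def bij_betw_def)

lemma d_I_class_le:
  assumes "persistence_module fun_scale M" "persistence_module fun_scale N"
    and "interleaved fun_scale e M N" "0 \<le> e"
  shows "d_I (pm_iso fun_scale `` {M}) (pm_iso fun_scale `` {N}) \<le> ereal e"
proof -
  have "d_I (pm_iso fun_scale `` {M}) (pm_iso fun_scale `` {N}) \<le> interleaving_distance fun_scale M N"
    unfolding d_I_def using pm_iso_refl[OF assms(1)] pm_iso_refl[OF assms(2)]
    by (intro INF_lower2[of M] INF_lower2[of N]) auto
  also have "\<dots> \<le> ereal e"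
    unfolding interleaving_distance_def using assms by (auto intro: Inf_lower)
  finally show ?thesis .
qed

lemma d_I_class_ge:
  assumes "\<And>M' N' e. (M, M') \<in> pm_iso fun_scale \<Longrightarrow> (N, N') \<in> pm_iso fun_scale \<Longrightarrow>
      interleaved fun_scale e M' N' \<Longrightarrow> 0 \<le> e \<Longrightarrow> r \<le> e"
  shows "ereal r \<le> d_I (pm_iso fun_scale `` {M}) (pm_iso fun_scale `` {N})"
  unfolding d_I_def interleaving_distance_def
  by (intro INF_greatest Inf_greatest) (use assms in auto)

lemma class_in_interval_sums:
  assumes "\<And>\<alpha>. \<alpha> \<in> A \<Longrightarrow> is_interval (I \<alpha>) \<and> I \<alpha> \<noteq> {}" "P A I"
  shows "pm_iso fun_scale `` {bar_sum A I} \<in> (interval_sums P :: (real \<Rightarrow> 'k::field) pmod set set)"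
proof -
  have "(bar_sum A I :: (real \<Rightarrow> 'k) pmod, pm_direct_sum A (\<lambda>\<alpha>. interval_module (I \<alpha>))) \<in> pm_iso fun_scale"
    using assms by (auto simp flip: bar_sum_def intro!: pm_iso_refl persistence_module_bar_sum)
  then show ?thesis
    unfolding interval_sums_def using assms by (intro quotientI) blast
qed

lemma class_in_pfd:
  assumes "\<And>\<alpha>. \<alpha> \<in> A \<Longrightarrow> is_interval (I \<alpha>)" "finite A"
  shows "pm_iso fun_scale `` {bar_sum A I} \<in> (pfd :: (real \<Rightarrow> 'k::field) pmod set set)"
  unfolding pfd_def
  by (intro quotientI CollectI conjI allI persistence_module_bar_sum finite_dim_bar_sum assms)

section \<open>Cubes of bars in separate cells\<close>

lemma infnorm_le_cart:
  fixes x :: "real ^ 'n"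
  assumes "\<And>i. \<bar>x $ i\<bar> \<le> r"
  shows "infnorm x \<le> r"
proof -
  have "\<bar>x \<bullet> b\<bar> \<le> r" if b: "b \<in> Basis" for b
  proof -
    obtain i where "b = axis i 1"
      using b by (auto simp: Basis_vec_def)
    then show ?thesis
      using assms[of i] by (simp add: inner_axis)
  qed
  then show ?thesis by (simp add: infnorm_Max)
qed

text \<open>
  The estimate behind the lower bound, in one direction. If the bar of \<open>i\<close> in \<open>M\<close> were more than \<open>e\<close>
  longer than that in \<open>N\<close>, shorten it by \<open>e\<close> at both ends. What remains would have to be covered by
  a single bar of \<open>N\<close>. Its left end lies in the \<open>i\<close>-th cell, and since distinct indices differ by at
  least 1, this excludes all bars but that of \<open>i\<close>, which ends too early.
\<close>

lemma interleaved_cells_length_diff_le: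
  fixes M N :: "(real \<Rightarrow> 'k::field) pmod" and u v :: "real \<Rightarrow> real"
  assumes isoM: "(bar_sum (real ` K) (\<lambda>\<alpha>. {c + 4 * \<epsilon> * \<alpha>..c + 4 * \<epsilon> * \<alpha> + 2 * \<epsilon> + u \<alpha>}), M) \<in> pm_iso fun_scale"
    and isoN: "(bar_sum (real ` K) (\<lambda>\<alpha>. {c + 4 * \<epsilon> * \<alpha>..c + 4 * \<epsilon> * \<alpha> + 2 * \<epsilon> + v \<alpha>}), N) \<in> pm_iso fun_scale"
    and il: "interleaved fun_scale e M N" and "0 \<le> e" "0 < \<epsilon>"
    and u: "\<And>\<alpha>. \<alpha> \<in> real ` K \<Longrightarrow> u \<alpha> \<in> {0..\<epsilon>}" and v: "\<And>\<alpha>. \<alpha> \<in> real ` K \<Longrightarrow> v \<alpha> \<in> {0..\<epsilon>}"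
    and i: "i \<in> real ` K"
  shows "u i - v i \<le> e"
proof (rule ccontr)
  assume "\<not> u i - v i \<le> e"
  then have e: "e < \<epsilon>" "e < u i - v i"
    using u[OF i] v[OF i] by auto
  define s where "s = c + 4 * \<epsilon> * i + e"
  define t where "t = c + 4 * \<epsilon> * i + 2 * \<epsilon> + u i - e"
  have "s \<le> t"
    using e u[OF i] by (simp add: s_def t_def)
  moreover have "s - e \<in> {c + 4 * \<epsilon> * i..c + 4 * \<epsilon> * i + 2 * \<epsilon> + u i}"
    "t + e \<in> {c + 4 * \<epsilon> * i..c + 4 * \<epsilon> * i + 2 * \<epsilon> + u i}"
    using \<open>0 < \<epsilon>\<close> u[OF i] by (auto simp: s_def t_def)
  ultimately obtain j where j: "j \<in> real ` K"
    "s \<in> {c + 4 * \<epsilon> * j..c + 4 * \<epsilon> * j + 2 * \<epsilon> + v j}"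
    "t \<in> {c + 4 * \<epsilon> * j..c + 4 * \<epsilon> * j + 2 * \<epsilon> + v j}"
    by (rule interleaved_bar_sum_imp_bar[OF isoM isoN il \<open>0 \<le> e\<close> _ i])
  have "\<epsilon> * (i - j) < \<epsilon> * 1" "\<epsilon> * (j - i) < \<epsilon> * 1"
    using j(2) v[OF j(1)] e \<open>0 \<le> e\<close> by (auto simp: s_def algebra_simps)
  then have "i - j < 1" "j - i < 1"
    using \<open>0 < \<epsilon>\<close> by (simp_all only: mult_less_cancel_left_pos)
  moreover obtain m n where "i = real m" "j = real n"
    using i j(1) by blast
  ultimately have "i = j" by simp
  then show False
    using j(3) e by (simp add: t_def)
qed

theorem theorem1p1:
  fixes c d :: real
  assumes "c < d"
  shows "\<exists>\<epsilon>>0. \<forall>X\<in>{ffid_within c d, ffid, fid, cfid, cid, pfd, rid :: (real \<Rightarrow> 'k::field) pmod set set}.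
           \<exists>\<Phi> :: real ^ 'n \<Rightarrow> (real \<Rightarrow> 'k) pmod set.
             \<Phi> ` cbox 0 (\<chi> i. \<epsilon>) \<subseteq> X \<and>
             (\<forall>x\<in>cbox 0 (\<chi> i. \<epsilon>). \<forall>y\<in>cbox 0 (\<chi> i. \<epsilon>). d_I (\<Phi> x) (\<Phi> y) = ereal (infnorm (x - y)))"
proof -
  define n where "n = CARD('n)"
  have "n > 0" by (simp add: n_def)
  define \<epsilon> where "\<epsilon> = (d - c) / (4 * real n)"
  have "\<epsilon> > 0" using assms \<open>n > 0\<close> by (simp add: \<epsilon>_def)
  have eps_n: "4 * \<epsilon> * real n = d - c" using \<open>n > 0\<close> by (simp add: \<epsilon>_def)
  obtain h where h: "bij_betw h (UNIV :: 'n set) {0..<n}"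
    using ex_bij_betw_finite_nat[of "UNIV :: 'n set"] by (auto simp: n_def)
  define A where "A = real ` {0..<n}"
  \<comment> \<open>Bars are indexed by the reals \<open>0, \<dots>, n - 1\<close>; rounding recovers the number of the coordinate.\<close>
  define coord :: "real ^ 'n \<Rightarrow> real \<Rightarrow> real" where "coord x \<alpha> = x $ inv h (nat \<lfloor>\<alpha>\<rfloor>)" for x \<alpha>
  define bars where "bars x \<alpha> = {c + 4 * \<epsilon> * \<alpha>..c + 4 * \<epsilon> * \<alpha> + 2 * \<epsilon> + coord x \<alpha>}" for x \<alpha>
  define \<Phi> :: "real ^ 'n \<Rightarrow> (real \<Rightarrow> 'k) pmod set" where "\<Phi> x = pm_iso fun_scale `` {bar_sum A (bars x)}" for x
  have hA: "real (h i) \<in> A" for i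
    using h by (auto simp: A_def bij_betw_def)
  have coord_h: "coord x (real (h i)) = x $ i" for x i
    using h by (simp add: coord_def bij_betw_def)
  have coord_box: "coord x \<alpha> \<in> {0..\<epsilon>}" if "x \<in> cbox 0 (\<chi> i. \<epsilon>)" for x \<alpha>
    using that by (simp add: coord_def mem_box_cart)
  have interval: "is_interval (bars x \<alpha>)" "bounded (bars x \<alpha>)" for x \<alpha>
    by (auto simp: bars_def is_interval_cc)
  have nonempty: "bars x \<alpha> \<noteq> {}" if "x \<in> cbox 0 (\<chi> i. \<epsilon>)" for x \<alpha>
    using coord_box[OF that, of \<alpha>] \<open>\<epsilon> > 0\<close> by (simp add: bars_def)
  have within: "bars x \<alpha> \<subseteq> {c..d}" if x: "x \<in> cbox 0 (\<chi> i. \<epsilon>)" and \<alpha>: "\<alpha> \<in> A" for x \<alpha>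
  proof -
    have "0 \<le> \<alpha>" "\<alpha> + 1 \<le> real n" using \<alpha> by (auto simp: A_def)
    then have "4 * \<epsilon> * (\<alpha> + 1) \<le> d - c" "0 \<le> 4 * \<epsilon> * \<alpha>"
      using \<open>\<epsilon> > 0\<close> by (auto simp flip: eps_n intro!: mult_left_mono)
    then show ?thesis
      using coord_box[OF x, of \<alpha>] \<open>\<epsilon> > 0\<close> by (auto simp: bars_def algebra_simps)
  qed
  have "finite A" by (simp add: A_def)
  have mem: "\<Phi> x \<in> X"
    if "x \<in> cbox 0 (\<chi> i. \<epsilon>)" and "X \<in> {ffid_within c d, ffid, fid, cfid, cid, pfd, rid}" for x X
  proof -
    have "\<Phi> x \<in> interval_sums P" if "P A (bars x)" for P
      unfolding \<Phi>_def using that interval nonempty \<open>x \<in> _\<close> by (intro class_in_interval_sums) auto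
    moreover have "\<Phi> x \<in> pfd"
      unfolding \<Phi>_def using interval \<open>finite A\<close> by (intro class_in_pfd)
    ultimately show ?thesis
      using that within interval \<open>finite A\<close>
      by (auto simp: ffid_within_def ffid_def fid_def cfid_def cid_def rid_def countable_finite)
  qed
  have dist: "d_I (\<Phi> x) (\<Phi> y) = ereal (infnorm (x - y))"
    if x: "x \<in> cbox 0 (\<chi> i. \<epsilon>)" and y: "y \<in> cbox 0 (\<chi> i. \<epsilon>)" for x y
  proof (rule antisym)
    have "\<bar>coord x \<alpha> - coord y \<alpha>\<bar> \<le> infnorm (x - y)" for \<alpha>
      using component_le_infnorm_cart[of "x - y"] by (simp add: coord_def)
    then have "interleaved fun_scale (infnorm (x - y)) (bar_sum A (bars x) :: (real \<Rightarrow> 'k) pmod) (bar_sum A (bars y))"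
      unfolding bars_def by (intro interleaved_perturb_endpoints) (auto simp: infnorm_pos_le)
    then show "d_I (\<Phi> x) (\<Phi> y) \<le> ereal (infnorm (x - y))"
      unfolding \<Phi>_def by (intro d_I_class_le persistence_module_bar_sum interval infnorm_pos_le)
    show "ereal (infnorm (x - y)) \<le> d_I (\<Phi> x) (\<Phi> y)"
      unfolding \<Phi>_def
    proof (rule d_I_class_ge)
      fix M N :: "(real \<Rightarrow> 'k) pmod" and e
      assume M: "(bar_sum A (bars x), M) \<in> pm_iso fun_scale" and N: "(bar_sum A (bars y), N) \<in> pm_iso fun_scale"
        and il: "interleaved fun_scale e M N" and "0 \<le> e"
      have "coord x \<alpha> - coord y \<alpha> \<le> e" "coord y \<alpha> - coord x \<alpha> \<le> e" if "\<alpha> \<in> A" for \<alpha>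
        using interleaved_cells_length_diff_le[OF M[unfolded bars_def A_def] N[unfolded bars_def A_def] il \<open>0 \<le> e\<close> \<open>\<epsilon> > 0\<close>]
          interleaved_cells_length_diff_le[OF N[unfolded bars_def A_def] M[unfolded bars_def A_def] interleaved_sym[OF il] \<open>0 \<le> e\<close> \<open>\<epsilon> > 0\<close>]
          coord_box[OF x] coord_box[OF y] that
        unfolding A_def by blast+
      from this[OF hA] show "infnorm (x - y) \<le> e"
        by (intro infnorm_le_cart) (simp add: coord_h abs_le_iff)
    qed
  qed
  show ?thesis
    using \<open>\<epsilon> > 0\<close> mem dist by (intro exI[of _ \<epsilon>] conjI ballI exI[of _ \<Phi>]) auto
qed

end
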